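(* Let $k(\boldsymbol x)\ge\kappa_1>0$. The grid operator of diffusive transport $$(Dy)_i=-\frac1{V_i}\sum_{j\in\mathcal W(i)}l_{ij}\,k(\boldsymbol x_{ij})\,\frac{y_j-y_i}{d(\boldsymbol x_i,\boldsymbol x_j)},\qquad \boldsymbol x_i\in\omega,$$ acting on grid functions vanishing on $\partial\omega$, satisfies $$D=D^*\ge\frac{\kappa_1}{M_0}E$$ for the grid functions from the space $H=L_2(\omega)$, with $$M_0=\frac{l_1^2}{16}+\frac{l_2^2}{16},$$ where $l_1,l_2$ are the side lengths of the rectangle with sides parallel to the coordinate axes that contains completely the whole polygon $\Omega$.
   Context: $\Omega\subset\mathbb R^2$ is a convex polygon with boundary $\partial\Omega$, $\overline\Omega=\Omega\cup\partial\Omega$. The grid $\overline\omega$ consists of nodes $\boldsymbol x_i$, $i=1,\dots,M$, in $\overline\Omega$, and the vertices of $\Omega$ are nodes; $\omega=\overline\omega\cap\Omega$ is the set of interior nodes and $\partial\omega=\overline\omega\cap\partial\Omega$ the set of boundary nodes. Each node $\boldsymbol x_i$ is associated with a control volume $\Omega_i$, which is its Voronoi polygon (the set of points lying closer to $\boldsymbol x_i$ than to all the other nodes) or the part of that polygon belonging to $\Omega$; the control volumes cover $\overline\Omega$ and do not overlap. $\Gamma_{ij}=\partial\Omega_i\cap\partial\Omega_j$, $i\ne j$, denotes the common face of two control volumes; $\mathcal W(i)$ is the set of indices $j\neq i$ of the neighboring nodes, whose control volumes have a common face with $\Omega_i$. $V_i$ is the area of $\Omega_i$, $l_{ij}$ is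 the length of $\Gamma_{ij}$, $d(\boldsymbol x_i,\boldsymbol x_j)$ is the Euclidean distance, and $\boldsymbol x_{ij}=(\boldsymbol x_i+\boldsymbol x_j)/2$. The diffusion coefficient $k$ is a sufficiently smooth function. $H=L_2(\omega)$ is the space of grid functions $y_i=y(\boldsymbol x_i)$ on $\overline\omega$ vanishing on $\partial\omega$, with scalar product $(y,w)=\sum_{\boldsymbol x_i\in\omega}V_iy_iw_i$. $E$ is the identity operator, and $D\ge cE$ means $(Dy,y)\ge c\,(y,y)$ for all $y\in H$.
   Formalization: Only boundary nodes' Voronoi polygons may be cut off by the boundary of Ω; those of interior nodes must lie in the closure of Ω. Otherwise the bound fails, e.g. for a thin rectangle whose nodes are its vertices and centre (D ≈ 8/L² against 16/L²). *)

theory Defs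
  imports "HOL-Analysis.Analysis"
begin

definition convex_polygon :: "(real^2) set \<Rightarrow> bool" where
  "convex_polygon \<Omega> \<longleftrightarrow> open \<Omega> \<and> \<Omega> \<noteq> {} \<and> convex \<Omega> \<and> polytope (closure \<Omega>)"

text \<open>Cells are closed (non-strict inequality), so that they can cover \<open>closure \<Omega>\<close>. Passing to
  the strict inequality changes neither their areas nor their boundaries.\<close>

definition voronoi_polygon :: "nat \<Rightarrow> (nat \<Rightarrow> real^2) \<Rightarrow> nat \<Rightarrow> (real^2) set" where
  "voronoi_polygon M x i = {p. \<forall>j\<in>{1..M}. dist p (x i) \<le> dist p (x j)}"

text \<open>The control volume of an interior node is its whole Voronoi polygon; only the Voronoi
  polygons of boundary nodes are cut off by the boundary of \<open>\<Omega>\<close>.\<close>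

definition control_volume ::
    "(real^2) set \<Rightarrow> nat \<Rightarrow> (nat \<Rightarrow> real^2) \<Rightarrow> nat \<Rightarrow> (real^2) set" where
  "control_volume \<Omega> M x i =
     (if x i \<in> \<Omega> then voronoi_polygon M x i else voronoi_polygon M x i \<inter> closure \<Omega>)"

text \<open>The covering condition is an equality: it forces the Voronoi polygons of interior nodes to
  lie in \<open>closure \<Omega>\<close>. Without this, interior control volumes could have edges on the
  boundary of \<open>\<Omega>\<close>, across which the operator below has no flux term.\<close>

definition voronoi_grid :: "(real^2) set \<Rightarrow> nat \<Rightarrow> (nat \<Rightarrow> real^2) \<Rightarrow> bool" where
  "voronoi_grid \<Omega> M x \<longleftrightarrow>
     inj_on x {1..M} \<and>
     x ` {1..M} \<subseteq> closure \<Omega> \<and>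
     {v. v extreme_point_of closure \<Omega>} \<subseteq> x ` {1..M} \<and>
     (\<Union>i\<in>{1..M}. control_volume \<Omega> M x i) = closure \<Omega> \<and>
     (\<forall>i\<in>{1..M}. \<forall>j\<in>{1..M}. i \<noteq> j \<longrightarrow>
        interior (control_volume \<Omega> M x i) \<inter> interior (control_volume \<Omega> M x j) = {})"

definition interior_indices :: "(real^2) set \<Rightarrow> nat \<Rightarrow> (nat \<Rightarrow> real^2) \<Rightarrow> nat set" where
  "interior_indices \<Omega> M x = {i\<in>{1..M}. x i \<in> \<Omega>}"

definition cell_area :: "(real^2) set \<Rightarrow> nat \<Rightarrow> (nat \<Rightarrow> real^2) \<Rightarrow> nat \<Rightarrow> real" where
  "cell_area \<Omega> M x i = measure lborel (control_volume \<Omega> M x i)"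

definition face ::
    "(real^2) set \<Rightarrow> nat \<Rightarrow> (nat \<Rightarrow> real^2) \<Rightarrow> nat \<Rightarrow> nat \<Rightarrow> (real^2) set" where
  "face \<Omega> M x i j = frontier (control_volume \<Omega> M x i) \<inter> frontier (control_volume \<Omega> M x j)"

text \<open>For distinct nodes of a grid, a face is empty or a (possibly degenerate) line segment on
  the perpendicular bisector of the two nodes, so its diameter is its length.\<close>

definition face_length ::
    "(real^2) set \<Rightarrow> nat \<Rightarrow> (nat \<Rightarrow> real^2) \<Rightarrow> nat \<Rightarrow> nat \<Rightarrow> real" where
  "face_length \<Omega> M x i j = diameter (face \<Omega> M x i j)"

text \<open>Control volumes that meet in a single point do not have a common face.\<close>

definition neighbours :: "(real^2) set \<Rightarrow> nat \<Rightarrow> (nat \<Rightarrow> real^2) \<Rightarrow> nat \<Rightarrow> nat set" where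
  "neighbours \<Omega> M x i = {j\<in>{1..M}. j \<noteq> i \<and> face_length \<Omega> M x i j > 0}"

text \<open>Grid functions are indexed by node numbers and are normalised to \<open>0\<close> outside
  \<open>{1..M}\<close>; the elements of the space below also vanish at the boundary nodes.\<close>

definition grid_space :: "(real^2) set \<Rightarrow> nat \<Rightarrow> (nat \<Rightarrow> real^2) \<Rightarrow> (nat \<Rightarrow> real) set" where
  "grid_space \<Omega> M x = {y. \<forall>i. i \<notin> interior_indices \<Omega> M x \<longrightarrow> y i = 0}"

definition grid_inner ::
    "(real^2) set \<Rightarrow> nat \<Rightarrow> (nat \<Rightarrow> real^2) \<Rightarrow> (nat \<Rightarrow> real) \<Rightarrow> (nat \<Rightarrow> real) \<Rightarrow> real" where
  "grid_inner \<Omega> M x y w = (\<Sum>i\<in>interior_indices \<Omega> M x. cell_area \<Omega> M x i * y i * w i)"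

definition diffusion_op ::
    "(real^2) set \<Rightarrow> nat \<Rightarrow> (nat \<Rightarrow> real^2) \<Rightarrow> (real^2 \<Rightarrow> real) \<Rightarrow> (nat \<Rightarrow> real) \<Rightarrow> (nat \<Rightarrow> real)" where
  "diffusion_op \<Omega> M x k y i =
     (if i \<in> interior_indices \<Omega> M x
      then - (1 / cell_area \<Omega> M x i) *
             (\<Sum>j\<in>neighbours \<Omega> M x i.
                face_length \<Omega> M x i j * k ((1/2) *\<^sub>R (x i + x j)) * ((y j - y i) / dist (x i) (x j)))
      else 0)"

definition is_adjoint ::
    "(real^2) set \<Rightarrow> nat \<Rightarrow> (nat \<Rightarrow> real^2) \<Rightarrow>
     ((nat \<Rightarrow> real) \<Rightarrow> (nat \<Rightarrow> real)) \<Rightarrow> ((nat \<Rightarrow> real) \<Rightarrow> (nat \<Rightarrow> real)) \<Rightarrow> bool" where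
  "is_adjoint \<Omega> M x A B \<longleftrightarrow>
     (\<forall>y\<in>grid_space \<Omega> M x. A y \<in> grid_space \<Omega> M x \<and> B y \<in> grid_space \<Omega> M x) \<and>
     (\<forall>y\<in>grid_space \<Omega> M x. \<forall>w\<in>grid_space \<Omega> M x.
        grid_inner \<Omega> M x (A y) w = grid_inner \<Omega> M x y (B w))"

text \<open>The operator inequality \<open>A \<ge> c E\<close>.\<close>

definition bounded_below_by ::
    "(real^2) set \<Rightarrow> nat \<Rightarrow> (nat \<Rightarrow> real^2) \<Rightarrow>
     ((nat \<Rightarrow> real) \<Rightarrow> (nat \<Rightarrow> real)) \<Rightarrow> real \<Rightarrow> bool" where
  "bounded_below_by \<Omega> M x A c \<longleftrightarrow>
     (\<forall>y\<in>grid_space \<Omega> M x. grid_inner \<Omega> M x (A y) y \<ge> c * grid_inner \<Omega> M x y y)"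

definition continuously_differentiable_on :: "(real^2) set \<Rightarrow> (real^2 \<Rightarrow> real) \<Rightarrow> bool" where
  "continuously_differentiable_on S k \<longleftrightarrow>
     (\<exists>g. (\<forall>p\<in>S. (k has_derivative (\<lambda>h. g p \<bullet> h)) (at p within S)) \<and> continuous_on S g)"

end

theory Submission
  imports Defs
begin

text \<open>The quadratic form of the operator is a sum of squared differences, so \<open>k\<close> may be replaced by
  \<open>\<kappa>\<^sub>1\<close>. For \<open>k = 1\<close> the function \<open>\<phi> p = (p - a) \<bullet> (b - p) / 4\<close> satisfies \<open>D \<phi> = 1\<close> exactly at the
  interior nodes: each face lies on the perpendicular bisector of its two nodes, so the flux of a
  quadratic function across it is that of an affine field, for which the divergence theorem on a
  convex polygon is elementary.
  Since \<open>0 < \<phi> \<le> M\<^sub>0\<close> at interior nodes and \<open>\<phi> \<ge> 0\<close> on the boundary, Picone's inequality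
  \<open>(y\<^sub>i - y\<^sub>j)\<^sup>2 \<ge> (\<phi>\<^sub>i - \<phi>\<^sub>j) (y\<^sub>i\<^sup>2 / \<phi>\<^sub>i - y\<^sub>j\<^sup>2 / \<phi>\<^sub>j)\<close> and summation by parts give
  \<open>(D y, y) \<ge> (y / \<phi>, y) \<ge> (y, y) / M\<^sub>0\<close>.\<close>

section \<open>Areas and edge vectors of convex polygons in the plane\<close>

lemma diameter_closed_segment:
  fixes a b :: "'a::euclidean_space"
  shows "diameter (closed_segment a b) = dist a b"
proof (rule antisym)
  show "diameter (closed_segment a b) \<le> dist a b"
  proof (rule diameter_le)
    fix p q assume "p \<in> closed_segment a b" "q \<in> closed_segment a b"
    then obtain u v where "u \<in> {a, b}" "v \<in> {a, b}" "norm (p - q) \<le> norm (u - v)"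
      using simplex_extremal_le_exists[of "{a, b}" p q] unfolding segment_convex_hull by blast
    then show "norm (p - q) \<le> dist a b"
      by (auto simp: dist_norm norm_minus_commute intro: order_trans[OF _ norm_ge_zero])
  qed auto
  show "dist a b \<le> diameter (closed_segment a b)"
    using diameter_bounded_bound[of "closed_segment a b" a b] by (simp add: bounded_closed_segment)
qed

text \<open>Half base times height: \<open>h - w \<bullet> q\<close> divided by
  \<open>norm w\<close> is the distance of \<open>q\<close> from the line carrying the side. Working
  with the squared determinant makes orientation irrelevant.\<close>

lemma content_triangle_base_height:
  fixes a b q w :: "real^2"
  assumes "w \<noteq> 0" "w \<bullet> a = h" "w \<bullet> b = h" "w \<bullet> q \<le> h"
  shows "measure lborel (convex hull {q, a, b}) = dist a b * (h - w \<bullet> q) / (2 * norm w)"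
proof -
  define D where "D = (b$1 - q$1) * (a$2 - q$2) - (a$1 - q$1) * (b$2 - q$2)"
  have n2: "(norm v)\<^sup>2 = (v$1)\<^sup>2 + (v$2)\<^sup>2" for v :: "real^2"
    unfolding power2_norm_eq_inner by (simp add: inner_vec_def sum_2 power2_eq_square)
  have wa: "w$1 * a$1 + w$2 * a$2 = h" and wb: "w$1 * b$1 + w$2 * b$2 = h"
    using assms by (simp_all add: inner_vec_def sum_2)
  \<comment> \<open>Unless \<open>w\<close> is zero, when both sides vanish, a plane vector
    orthogonal to \<open>w\<close> is a multiple of \<open>w\<close> turned by a right angle, so its
    determinant with any \<open>m\<close> is, up to sign, that multiple of the inner product of
    \<open>w\<close> and \<open>m\<close>.\<close>
  have *: "(e1 * m2 - m1 * e2)\<^sup>2 * (w1\<^sup>2 + w2\<^sup>2) = (e1\<^sup>2 + e2\<^sup>2) * (w1 * m1 + w2 * m2)\<^sup>2"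
    if "w1 * e1 + w2 * e2 = 0" for e1 e2 m1 m2 w1 w2 :: real
    using that by algebra
  have D: "D = (a$1 - b$1) * (q$2 - a$2) - (q$1 - a$1) * (a$2 - b$2)"
    unfolding D_def by (simp add: algebra_simps)
  have "D\<^sup>2 * ((w$1)\<^sup>2 + (w$2)\<^sup>2)
      = ((a$1 - b$1)\<^sup>2 + (a$2 - b$2)\<^sup>2) * (w$1 * (q$1 - a$1) + w$2 * (q$2 - a$2))\<^sup>2"
    unfolding D by (rule *) (use wa wb in \<open>simp add: algebra_simps\<close>)
  also have "(w$1 * (q$1 - a$1) + w$2 * (q$2 - a$2))\<^sup>2 = (h - (w$1 * q$1 + w$2 * q$2))\<^sup>2"
    using wa by (subst power2_commute) (simp add: algebra_simps)
  finally have "D\<^sup>2 * ((w$1)\<^sup>2 + (w$2)\<^sup>2)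
      = ((a$1 - b$1)\<^sup>2 + (a$2 - b$2)\<^sup>2) * (h - (w$1 * q$1 + w$2 * q$2))\<^sup>2" .
  then have "(\<bar>D\<bar> * norm w)\<^sup>2 = (dist a b * (h - w \<bullet> q))\<^sup>2"
    by (simp add: power_mult_distrib n2 dist_norm inner_vec_def sum_2)
  then have "\<bar>D\<bar> * norm w = dist a b * (h - w \<bullet> q)"
    by (rule power2_eq_imp_eq) (use assms in auto)
  moreover have "measure lborel (convex hull {q, a, b}) = \<bar>D\<bar> / 2"
    unfolding content_triangle D_def by simp
  ultimately show ?thesis
    using assms(1) by (simp add: field_simps)
qed

lemma collinear_hyperplane_2:
  fixes w :: "real^2"
  assumes "w \<noteq> 0"
  shows "collinear {p. w \<bullet> p = h}"
proof -
  have "aff_dim {p. w \<bullet> p = h} = 1"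
    using aff_dim_hyperplane[OF assms, of h] by simp
  then show ?thesis
    by (simp add: collinear_aff_dim)
qed

text \<open>The polygon is cut into triangles with apex \<open>q\<close>, one over each edge. The triangle over edge
  \<open>j\<close> consists of the points \<open>p\<close> where \<open>w j \<bullet> (p - q) / (h j - w j \<bullet> q)\<close> is maximal.\<close>

lemma polygon_area:
  fixes J :: "'i set" and w :: "'i \<Rightarrow> real^2" and h :: "'i \<Rightarrow> real" and q :: "real^2"
  defines "P \<equiv> {p. \<forall>j\<in>J. w j \<bullet> p \<le> h j}"
  assumes fin: "finite J" and bdd: "bounded P"
    and q: "\<And>j. j \<in> J \<Longrightarrow> w j \<bullet> q < h j"
    and nz: "\<And>j. j \<in> J \<Longrightarrow> w j \<noteq> 0"
    and dist: "\<And>i j c. i \<in> J \<Longrightarrow> j \<in> J \<Longrightarrow> i \<noteq> j \<Longrightarrow> w i = c *\<^sub>R w j \<Longrightarrow> h i \<noteq> c * h j"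
  shows "measure lborel P =
    (\<Sum>j\<in>J. diameter (P \<inter> {p. w j \<bullet> p = h j}) * (h j - w j \<bullet> q) / (2 * norm (w j)))"
proof -
  define F where "F j = P \<inter> {p. w j \<bullet> p = h j}" for j
  define T where "T j = convex hull (insert q (F j))" for j
  define \<eta> where "\<eta> j = h j - w j \<bullet> q" for j
  \<comment> \<open>Rescaled so that side \<open>j\<close> is where \<open>u j (p - q) = 1\<close>;
    the triangles are then pieces of cones with apex \<open>q\<close> described by the linear
    functions \<open>u j\<close>.\<close>
  define u where "u j v = w j \<bullet> v / \<eta> j" for j v
  have \<eta>: "\<eta> j > 0" if "j \<in> J" for j
    using q[OF that] by (simp add: \<eta>_def)
  have P_iff: "p \<in> P \<longleftrightarrow> (\<forall>j\<in>J. u j (p - q) \<le> 1)" for p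
    using \<eta> by (auto simp: P_def u_def \<eta>_def divide_simps inner_diff_right)
  have F_iff: "p \<in> F j \<longleftrightarrow> p \<in> P \<and> u j (p - q) = 1" if "j \<in> J" for p j
    using \<eta>[OF that] by (auto simp: F_def u_def \<eta>_def divide_simps inner_diff_right)
  have u_scale: "u j (t *\<^sub>R v) = t * u j v" for j t v
    by (simp add: u_def)
  have P_eq: "P = (\<Inter>j\<in>J. {p. w j \<bullet> p \<le> h j})"
    by (auto simp: P_def)
  have clP: "closed P" and cvP: "convex P"
    unfolding P_eq by (auto intro!: closed_INT closed_halfspace_le convex_INT convex_halfspace_le)
  have cF: "compact (F j)" and vF: "convex (F j)" for j
    unfolding F_def using clP bdd cvP
    by (auto intro!: closed_Int_compact[of "{p. w j \<bullet> p = h j}" P, simplified Int_commute]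
        closed_hyperplane convex_Int convex_hyperplane simp: compact_eq_bounded_closed Int_commute)
  have qP: "q \<in> P"
    using q by (force simp: P_def)
  have Jne: "J \<noteq> {}"
  proof
    assume "J = {}"
    then have "P = UNIV" by (simp add: P_def)
    with bdd show False by (simp add: not_bounded_UNIV)
  qed
  have TP: "T j \<subseteq> P" for j
    unfolding T_def by (rule hull_minimal) (use qP cvP in \<open>auto simp: F_def\<close>)
  \<comment> \<open>Along a segment from \<open>q\<close> all \<open>u k\<close> grow in proportion,
    so it suffices to compare them at the end on \<open>F j\<close>, where \<open>u j\<close> is 1
    and no \<open>u k\<close> exceeds 1. If \<open>F j\<close> is empty, \<open>T j\<close> is only
    the apex.\<close>
  have T_cone: "u k (p - q) \<le> u j (p - q)" if "p \<in> T j" "j \<in> J" "k \<in> J" for p j k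
  proof (cases "F j = {}")
    case True
    with that show ?thesis by (simp add: T_def u_def)
  next
    case False
    then have "p \<in> (\<Union>f\<in>F j. closed_segment q f)"
      using that(1) vF[of j] by (simp add: T_def convex_hull_insert_segments hull_same)
    then obtain f where "f \<in> F j" "p \<in> closed_segment q f"
      by blast
    then obtain t where t: "0 \<le> t" "p - q = t *\<^sub>R (f - q)"
      by (auto simp: in_segment algebra_simps)
    have "u k (f - q) \<le> u j (f - q)"
      using \<open>f \<in> F j\<close> that F_iff P_iff by auto
    with t show ?thesis by (simp add: u_scale mult_left_mono)
  qed
  have cover: "P = \<Union>(T ` J)"
  proof
    show "\<Union>(T ` J) \<subseteq> P" using TP by blast
    show "P \<subseteq> \<Union>(T ` J)"
    proof
      fix p assume p: "p \<in> P"
      define v where "v = p - q"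
      obtain j where j: "j \<in> J" "\<And>k. k \<in> J \<Longrightarrow> u k v \<le> u j v"
        using obtains_MAX[OF fin Jne, of "\<lambda>k. u k v"] fin by (metis Max_ge finite_imageI imageI)
      show "p \<in> \<Union>(T ` J)"
      proof (cases "v = 0")
        case True
        then show ?thesis using j(1) by (auto simp: v_def T_def hull_inc)
      next
        case False
        define t where "t = u j v"
        \<comment> \<open>Otherwise no \<open>u k v\<close> is positive and the whole ray from
          \<open>q\<close> along \<open>v\<close> stays in \<open>P\<close>, which is
          bounded.\<close>
        have "t > 0"
        proof (rule ccontr)
          assume "\<not> t > 0"
          obtain B where B: "\<And>r. r \<in> P \<Longrightarrow> norm r \<le> B"
            using bdd by (auto simp: bounded_iff)
          \<comment> \<open>Long enough to carry \<open>q + s *\<^sub>R v\<close> out of the ball of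
            radius \<open>B\<close>.\<close>
          define s where "s = (\<bar>B\<bar> + norm q + 1) / norm v"
          have "s \<ge> 0" by (simp add: s_def)
          have "u k (s *\<^sub>R v) \<le> 0" if "k \<in> J" for k
            using j(2)[OF that] \<open>\<not> t > 0\<close> \<open>s \<ge> 0\<close> by (simp add: u_scale t_def mult_nonneg_nonpos)
          then have "q + s *\<^sub>R v \<in> P" by (force simp: P_iff)
          then have "norm (q + s *\<^sub>R v) \<le> B" by (rule B)
          moreover have "norm (s *\<^sub>R v) = \<bar>B\<bar> + norm q + 1"
            using False by (simp add: s_def)
          ultimately show False
            using norm_triangle_ineq4[of "q + s *\<^sub>R v" q] by simp
        qed
        have "t \<le> 1" using p j(1) by (simp add: P_iff t_def v_def)
        \<comment> \<open>The point where the ray from \<open>q\<close> through \<open>p\<close>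
          meets side \<open>j\<close>.\<close>
        define f where "f = q + (1 / t) *\<^sub>R v"
        have "u k (f - q) \<le> 1" if "k \<in> J" for k
          using j(2)[OF that] \<open>t > 0\<close> unfolding f_def by (simp add: u_scale t_def)
        moreover have "u j (f - q) = 1"
          using \<open>t > 0\<close> unfolding f_def by (simp add: u_scale t_def)
        ultimately have f: "f \<in> F j" using j(1) by (simp add: F_iff P_iff)
        have "p = (1 - t) *\<^sub>R q + t *\<^sub>R f"
          using \<open>t > 0\<close> by (simp add: f_def v_def algebra_simps)
        then have "p \<in> closed_segment q f"
          using \<open>t > 0\<close> \<open>t \<le> 1\<close> unfolding in_segment by (metis less_imp_le)
        then have "p \<in> T j"
          using f vF[of j] by (auto simp: T_def convex_hull_insert_segments hull_same)
        then show ?thesis using j(1) by blast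
      qed
    qed
  qed
  have neg: "negligible (T i \<inter> T j)" if "i \<in> J" "j \<in> J" "i \<noteq> j" for i j
  proof -
    \<comment> \<open>Common points of the two triangles satisfy
      \<open>u i (p - q) = u j (p - q)\<close>, a line through \<open>q\<close> with normal
      \<open>d\<close>. If \<open>d\<close> were zero, the two inequalities would be multiples of
      each other, against \<open>dist\<close>.\<close>
    define d where "d = w i /\<^sub>R \<eta> i - w j /\<^sub>R \<eta> j"
    have "d \<noteq> 0"
    proof
      assume "d = 0"
      then have "w i /\<^sub>R \<eta> i = w j /\<^sub>R \<eta> j" by (simp add: d_def)
      then have "\<eta> i *\<^sub>R (w i /\<^sub>R \<eta> i) = \<eta> i *\<^sub>R (w j /\<^sub>R \<eta> j)" by simp
      then have wi: "w i = (\<eta> i / \<eta> j) *\<^sub>R w j"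
        using \<eta>[OF that(1)] by (simp add: divide_inverse)
      have "h i = \<eta> i + w i \<bullet> q" by (simp add: \<eta>_def)
      also have "\<dots> = \<eta> i / \<eta> j * (\<eta> j + w j \<bullet> q)"
        using \<eta>[OF that(2)] by (simp add: wi field_simps)
      also have "\<dots> = \<eta> i / \<eta> j * h j" by (simp add: \<eta>_def)
      finally show False using dist[OF that wi] by simp
    qed
    have "T i \<inter> T j \<subseteq> {p. d \<bullet> p = d \<bullet> q}"
    proof
      fix p assume "p \<in> T i \<inter> T j"
      then have "u i (p - q) = u j (p - q)"
        using T_cone[of p i j] T_cone[of p j i] that by auto
      then have "d \<bullet> (p - q) = 0"
        by (simp add: d_def u_def inner_diff_left divide_inverse mult.commute)
      then show "p \<in> {p. d \<bullet> p = d \<bullet> q}" by (simp add: inner_diff_right)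
    qed
    with negligible_hyperplane[of d "d \<bullet> q"] \<open>d \<noteq> 0\<close> show ?thesis
      by (blast intro: negligible_subset)
  qed
  have cT: "compact (T j)" for j
    unfolding T_def by (intro compact_convex_hull compact_insert cF)
  have area: "measure lborel (T j) = diameter (F j) * (h j - w j \<bullet> q) / (2 * norm (w j))"
    if "j \<in> J" for j
  proof (cases "F j = {}")
    case True
    then show ?thesis by (simp add: T_def)
  next
    case False
    have "collinear (F j)"
      using collinear_hyperplane_2[OF nz[OF that]] by (rule collinear_subset) (auto simp: F_def)
    with False obtain a b where ab: "F j = closed_segment a b"
      using compact_convex_collinear_segment cF vF by metis
    have "T j = convex hull {q, a, b}"
      unfolding T_def ab segment_convex_hull by (metis hull_insert)
    moreover have "a \<in> F j" "b \<in> F j" by (simp_all add: ab)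
    then have "w j \<bullet> a = h j" "w j \<bullet> b = h j" by (simp_all add: F_def)
    ultimately show ?thesis
      using content_triangle_base_height[OF nz[OF that], of a "h j" b q] q[OF that]
      by (simp add: ab diameter_closed_segment)
  qed
  have "measure lebesgue P = (\<Sum>j\<in>J. measure lebesgue (T j))"
    unfolding cover
    by (rule measure_negligible_finite_Union_image[OF fin])
       (auto simp: pairwise_def neg intro: lmeasurable_compact cT)
  \<comment> \<open>The union rule concerns Lebesgue measure; compact sets are Borel, so
    \<open>lborel\<close> gives the same value.\<close>
  moreover have "measure lebesgue S = measure lborel S" if "compact S" for S :: "(real^2) set"
    using that by (simp add: measure_completion borel_compact)
  moreover have "compact P" using clP bdd by (simp add: compact_eq_bounded_closed)
  ultimately show ?thesis
    using area cT by (simp add: F_def)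
qed

text \<open>The area formula has a right-hand side affine in \<open>q\<close>, but the area does not depend on \<open>q\<close>;
  hence the linear part vanishes.\<close>

lemma polygon_closed:
  fixes J :: "'i set" and w :: "'i \<Rightarrow> real^2" and h :: "'i \<Rightarrow> real" and q :: "real^2"
  defines "P \<equiv> {p. \<forall>j\<in>J. w j \<bullet> p \<le> h j}"
  assumes fin: "finite J" and bdd: "bounded P"
    and q: "\<And>j. j \<in> J \<Longrightarrow> w j \<bullet> q < h j"
    and nz: "\<And>j. j \<in> J \<Longrightarrow> w j \<noteq> 0"
    and dist: "\<And>i j c. i \<in> J \<Longrightarrow> j \<in> J \<Longrightarrow> i \<noteq> j \<Longrightarrow> w i = c *\<^sub>R w j \<Longrightarrow> h i \<noteq> c * h j"
  shows "(\<Sum>j\<in>J. (diameter (P \<inter> {p. w j \<bullet> p = h j}) / norm (w j)) *\<^sub>R w j) = 0"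
proof -
  define L where "L j = diameter (P \<inter> {p. w j \<bullet> p = h j}) / norm (w j)" for j
  define S where "S = (\<Sum>j\<in>J. L j *\<^sub>R w j)"
  have area: "measure lborel P = (\<Sum>j\<in>J. L j * (h j - w j \<bullet> r)) / 2"
    if "\<And>j. j \<in> J \<Longrightarrow> w j \<bullet> r < h j" for r
    using polygon_area[of J w h r] assms that
    by (simp add: L_def P_def sum_divide_distrib mult.commute)
  \<comment> \<open>Finitely many strict inequalities hold at \<open>q\<close>, so it may be moved a
    little in any direction.\<close>
  have "open (\<Inter>j\<in>J. {p. w j \<bullet> p < h j})"
    using fin by (auto intro: open_INT open_halfspace_lt)
  moreover have "q \<in> (\<Inter>j\<in>J. {p. w j \<bullet> p < h j})" using q by auto
  ultimately obtain e where e: "e > 0" "cball q e \<subseteq> (\<Inter>j\<in>J. {p. w j \<bullet> p < h j})"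
    by (meson open_contains_cball)
  \<comment> \<open>Moving \<open>q\<close> along \<open>S\<close> itself changes the area formula
    by a multiple of \<open>S \<bullet> S\<close>, which must therefore vanish. The added 1 keeps
    the denominator positive if \<open>S\<close> is zero.\<close>
  define \<delta> where "\<delta> = e / (norm S + 1)"
  have \<delta>: "\<delta> > 0" using e(1) by (simp add: \<delta>_def add_nonneg_pos)
  have "\<delta> * norm S \<le> e"
    using e(1) by (simp add: \<delta>_def divide_simps add_nonneg_pos)
  then have "q + \<delta> *\<^sub>R S \<in> cball q e"
    using \<delta> by (simp add: dist_norm)
  then have "(\<Sum>j\<in>J. L j * (h j - w j \<bullet> (q + \<delta> *\<^sub>R S))) = (\<Sum>j\<in>J. L j * (h j - w j \<bullet> q))"
    using area[of q] area[of "q + \<delta> *\<^sub>R S"] q e(2) by auto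
  then have "\<delta> * (\<Sum>j\<in>J. L j * (w j \<bullet> S)) = 0"
    by (simp add: algebra_simps sum.distrib sum_subtractf sum_distrib_left)
  then have "S \<bullet> S = 0"
    using \<delta> by (simp add: S_def inner_sum_left)
  then show ?thesis by (simp add: S_def L_def)
qed

section \<open>Voronoi polygons: half-planes, area and edge vectors\<close>

lemma dist_le_dist_iff_halfspace:
  fixes p c d :: "'a::real_inner"
  shows "dist p c \<le> dist p d \<longleftrightarrow> (d - c) \<bullet> p \<le> (d \<bullet> d - c \<bullet> c) / 2"
  unfolding dist_norm norm_le by (simp add: inner_diff_left inner_diff_right inner_commute) argo

lemma voronoi_polygon_halfspaces:
  assumes "i \<in> {1..M}"
  shows "voronoi_polygon M x i =
    {p. \<forall>j\<in>{1..M} - {i}. (x j - x i) \<bullet> p \<le> (x j \<bullet> x j - x i \<bullet> x i) / 2}"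
  unfolding voronoi_polygon_def dist_le_dist_iff_halfspace[symmetric] by fastforce

lemma closed_voronoi_polygon: "closed (voronoi_polygon M x i)"
proof -
  have "voronoi_polygon M x i = (\<Inter>j\<in>{1..M}. {p. dist p (x i) \<le> dist p (x j)})"
    by (auto simp: voronoi_polygon_def)
  then show ?thesis
    by (auto intro!: closed_Collect_le continuous_on_dist)
qed

text \<open>A point of cell \<open>i\<close> already has \<open>x i\<close> as a nearest node, so it
  lies in cell \<open>j\<close> exactly when it is equidistant from both nodes.\<close>

lemma voronoi_polygon_Int:
  assumes "i \<in> {1..M}" "j \<in> {1..M}"
  shows "voronoi_polygon M x i \<inter> voronoi_polygon M x j =
    voronoi_polygon M x i \<inter> {p. (x j - x i) \<bullet> p = (x j \<bullet> x j - x i \<bullet> x i) / 2}"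
proof -
  have "p \<in> voronoi_polygon M x j \<longleftrightarrow> (x j - x i) \<bullet> p = (x j \<bullet> x j - x i \<bullet> x i) / 2"
    if "p \<in> voronoi_polygon M x i" for p
  proof -
    have "p \<in> voronoi_polygon M x j \<longleftrightarrow> dist p (x j) \<le> dist p (x i)"
      using that assms by (fastforce simp: voronoi_polygon_def)
    moreover have "dist p (x i) \<le> dist p (x j)"
      using that assms by (auto simp: voronoi_polygon_def)
    ultimately show ?thesis
      unfolding dist_le_dist_iff_halfspace by (simp add: inner_diff_left) argo
  qed
  then show ?thesis by blast
qed

text \<open>The two polygon lemmas with \<open>q = x i\<close>. Each edge lies on a perpendicular
  bisector, at half the distance to the neighbouring node; this half and the half of the triangle
  area give the factor 1/4.\<close>

lemma
  assumes inj: "inj_on x {1..M}" and i: "i \<in> {1..M}" and bdd: "bounded (voronoi_polygon M x i)"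
  shows voronoi_polygon_area:
      "measure lborel (voronoi_polygon M x i) =
        (\<Sum>j\<in>{1..M} - {i}.
          diameter (voronoi_polygon M x i \<inter> voronoi_polygon M x j) * dist (x i) (x j) / 4)"
    and voronoi_polygon_edges_closed:
      "(\<Sum>j\<in>{1..M} - {i}.
          (diameter (voronoi_polygon M x i \<inter> voronoi_polygon M x j) / dist (x i) (x j)) *\<^sub>R
          (x j - x i)) = 0"
proof -
  define w where "w j = x j - x i" for j
  define h where "h j = (x j \<bullet> x j - x i \<bullet> x i) / 2" for j
  define J where "J = {1..M} - {i}"
  have P: "voronoi_polygon M x i = {p. \<forall>j\<in>J. w j \<bullet> p \<le> h j}"
    using voronoi_polygon_halfspaces[OF i] by (simp add: w_def h_def J_def)
  have nz: "w j \<noteq> 0" if "j \<in> J" for j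
    using inj_onD[OF inj, of j i] that i by (auto simp: w_def J_def)
  have h_w: "h j - w j \<bullet> x i = (norm (w j))\<^sup>2 / 2" for j
    by (simp add: h_def w_def power2_norm_eq_inner inner_diff_left inner_diff_right
        inner_commute field_simps)
  have q: "w j \<bullet> x i < h j" if "j \<in> J" for j
    using h_w[of j] nz[OF that] by (smt (verit) half_gt_zero zero_less_norm_iff zero_less_power)
  have dist: "h j \<noteq> c * h k" if "j \<in> J" "k \<in> J" "j \<noteq> k" "w j = c *\<^sub>R w k" for j k c
  proof
    assume "h j = c * h k"
    \<comment> \<open>Scaling the normal by \<open>c\<close> scales this offset by \<open>c\<close>,
      but as half a squared norm it scales by the square of \<open>c\<close>. Hence
      \<open>c = 1\<close> and the two nodes coincide.\<close>
    then have "h j - w j \<bullet> x i = c * (h k - w k \<bullet> x i)"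
      by (simp add: that(4) right_diff_distrib)
    then have "c\<^sup>2 * (norm (w k))\<^sup>2 = c * (norm (w k))\<^sup>2"
      unfolding h_w by (simp add: that(4) power_mult_distrib)
    moreover have "c \<noteq> 0"
      using nz[OF that(1)] that(4) by auto
    ultimately have "c = 1"
      using nz[OF that(2)] by (auto simp: power2_eq_square)
    then have "x j = x k"
      using that(4) by (simp add: w_def)
    then show False
      using inj_onD[OF inj, of j k] that by (auto simp: J_def)
  qed
  have face: "voronoi_polygon M x i \<inter> voronoi_polygon M x j =
      {p. \<forall>j\<in>J. w j \<bullet> p \<le> h j} \<inter> {p. w j \<bullet> p = h j}" if "j \<in> J" for j
    unfolding P[symmetric] unfolding w_def h_def
    by (rule voronoi_polygon_Int) (use i that in \<open>auto simp: J_def\<close>)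
  have d: "dist (x i) (x j) = norm (w j)" for j
    by (simp add: w_def dist_norm norm_minus_commute)
  note hyps = finite_Diff[OF finite_atLeastAtMost, of 1 M "{i}", folded J_def]
    bdd[unfolded P] q nz dist
  have "measure lborel (voronoi_polygon M x i) = (\<Sum>j\<in>J.
      diameter ({p. \<forall>j\<in>J. w j \<bullet> p \<le> h j} \<inter> {p. w j \<bullet> p = h j}) *
      (h j - w j \<bullet> x i) / (2 * norm (w j)))"
    unfolding P by (rule polygon_area) (use hyps in auto)
  also have "\<dots> = (\<Sum>j\<in>J.
      diameter (voronoi_polygon M x i \<inter> voronoi_polygon M x j) * dist (x i) (x j) / 4)"
    by (rule sum.cong) (use nz in \<open>auto simp: face h_w d power2_eq_square\<close>)
  finally show "measure lborel (voronoi_polygon M x i) = (\<Sum>j\<in>{1..M} - {i}.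
      diameter (voronoi_polygon M x i \<inter> voronoi_polygon M x j) * dist (x i) (x j) / 4)"
    by (simp add: J_def)
  have "(\<Sum>j\<in>J. (diameter ({p. \<forall>j\<in>J. w j \<bullet> p \<le> h j} \<inter> {p. w j \<bullet> p = h j}) / norm (w j)) *\<^sub>R w j) = 0"
    by (rule polygon_closed) (use hyps in auto)
  then have "(\<Sum>j\<in>J. (diameter (voronoi_polygon M x i \<inter> voronoi_polygon M x j)
      / dist (x i) (x j)) *\<^sub>R w j) = 0"
    by (simp add: face d)
  then show "(\<Sum>j\<in>{1..M} - {i}. (diameter (voronoi_polygon M x i \<inter> voronoi_polygon M x j)
      / dist (x i) (x j)) *\<^sub>R (x j - x i)) = 0"
    by (simp add: J_def w_def)
qed

text \<open>Finitely many strict distance inequalities hold at the node, so a small disc around it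
  lies in its cell.\<close>

lemma voronoi_polygon_area_pos:
  assumes inj: "inj_on x {1..M}" and i: "i \<in> {1..M}" and bdd: "bounded (voronoi_polygon M x i)"
  shows "measure lborel (voronoi_polygon M x i) > 0"
proof -
  let ?U = "\<Inter>j\<in>{1..M} - {i}. {p. dist p (x i) < dist p (x j)}"
  have "open ?U"
    by (auto intro!: open_INT open_Collect_less continuous_intros)
  moreover have "x i \<in> ?U"
    using i by (auto dest: inj_onD[OF inj])
  ultimately obtain e where e: "e > 0" "ball (x i) e \<subseteq> ?U"
    by (meson open_contains_ball)
  moreover have "?U \<subseteq> voronoi_polygon M x i"
  proof
    fix p assume "p \<in> ?U"
    then have "dist p (x i) \<le> dist p (x j)" if "j \<in> {1..M}" for j
      using that by (cases "j = i") (auto intro: less_imp_le)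
    then show "p \<in> voronoi_polygon M x i"
      by (simp add: voronoi_polygon_def)
  qed
  ultimately have "ball (x i) e \<subseteq> voronoi_polygon M x i" by blast
  moreover have "voronoi_polygon M x i \<in> fmeasurable lborel"
    using closed_voronoi_polygon bdd by (intro fmeasurable_compact) (simp add: compact_eq_bounded_closed)
  ultimately have "measure lborel (ball (x i) e) \<le> measure lborel (voronoi_polygon M x i)"
    by (intro measure_mono_fmeasurable) auto
  then show ?thesis
    using content_ball_pos[OF e(1), of "x i"] by linarith
qed

section \<open>Control volumes and faces of interior nodes\<close>

lemma interior_voronoi_polygon_subset:
  assumes "voronoi_grid \<Omega> M x" "i \<in> interior_indices \<Omega> M x"
  shows "voronoi_polygon M x i \<subseteq> closure \<Omega>"
proof -
  have "control_volume \<Omega> M x i \<subseteq> (\<Union>i\<in>{1..M}. control_volume \<Omega> M x i)"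
    using assms(2) by (intro UN_upper) (simp add: interior_indices_def)
  also have "\<dots> = closure \<Omega>"
    using assms(1) unfolding voronoi_grid_def by blast
  finally show ?thesis
    using assms(2) by (simp add: interior_indices_def control_volume_def)
qed

lemma bounded_interior_voronoi_polygon:
  assumes "voronoi_grid \<Omega> M x" "bounded \<Omega>" "i \<in> interior_indices \<Omega> M x"
  shows "bounded (voronoi_polygon M x i)"
  using interior_voronoi_polygon_subset[OF assms(1,3)] assms(2)
  by (meson bounded_closure bounded_subset)

text \<open>Cell \<open>i\<close> lies in \<open>closure \<Omega>\<close>, so cutting off cell
  \<open>j\<close> loses no common point. The common points lie on the bisector, which misses both
  interiors, so they are frontier points of both control volumes.\<close>

lemma face_eq_voronoi_polygon_Int:
  assumes grid: "voronoi_grid \<Omega> M x" and i: "i \<in> interior_indices \<Omega> M x"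
    and j: "j \<in> {1..M}" "j \<noteq> i"
  shows "face \<Omega> M x i j = voronoi_polygon M x i \<inter> voronoi_polygon M x j"
proof -
  have iM: "i \<in> {1..M}" and cvi: "control_volume \<Omega> M x i = voronoi_polygon M x i"
    using i by (auto simp: interior_indices_def control_volume_def)
  note sub = interior_voronoi_polygon_subset[OF grid i]
  define w where "w = x j - x i"
  define h where "h = (x j \<bullet> x j - x i \<bullet> x i) / 2"
  have "inj_on x {1..M}"
    using grid by (simp add: voronoi_grid_def)
  then have "w \<noteq> 0"
    using inj_onD[of x "{1..M}" j i] iM j by (auto simp: w_def)
  have Hi: "voronoi_polygon M x i \<subseteq> {p. w \<bullet> p \<le> h}"
    unfolding w_def h_def dist_le_dist_iff_halfspace[symmetric]
    using j by (auto simp: voronoi_polygon_def)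
  have Hj: "voronoi_polygon M x j \<subseteq> {p. h \<le> w \<bullet> p}"
  proof
    fix p assume "p \<in> voronoi_polygon M x j"
    then have "dist p (x j) \<le> dist p (x i)"
      using iM by (auto simp: voronoi_polygon_def)
    then show "p \<in> {p. h \<le> w \<bullet> p}"
      unfolding dist_le_dist_iff_halfspace by (simp add: w_def h_def inner_diff_left)
  qed
  have cvj: "control_volume \<Omega> M x j \<subseteq> voronoi_polygon M x j"
    by (auto simp: control_volume_def)
  have int_i: "interior (control_volume \<Omega> M x i) \<subseteq> {p. w \<bullet> p < h}"
    using interior_mono[OF Hi] \<open>w \<noteq> 0\<close> by (simp add: cvi)
  have int_j: "interior (control_volume \<Omega> M x j) \<subseteq> {p. h < w \<bullet> p}"
    using interior_mono[OF order_trans[OF cvj Hj]] \<open>w \<noteq> 0\<close> by simp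
  have cl: "closure (control_volume \<Omega> M x m) = control_volume \<Omega> M x m" for m
    by (rule closure_closed) (auto simp: control_volume_def closed_voronoi_polygon)
  show ?thesis
  proof
    show "face \<Omega> M x i j \<subseteq> voronoi_polygon M x i \<inter> voronoi_polygon M x j"
      using cvj cl[of i] cl[of j] by (auto simp: face_def frontier_def cvi)
    show "voronoi_polygon M x i \<inter> voronoi_polygon M x j \<subseteq> face \<Omega> M x i j"
    proof
      fix p assume p: "p \<in> voronoi_polygon M x i \<inter> voronoi_polygon M x j"
      then have "p \<in> control_volume \<Omega> M x j"
        using sub by (auto simp: control_volume_def)
      moreover have "w \<bullet> p = h"
        using p Hi Hj by force
      ultimately show "p \<in> face \<Omega> M x i j"
        using p cl[of i] cl[of j] int_i int_j by (auto simp: face_def frontier_def cvi)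
    qed
  qed
qed

section \<open>Face conductances and the exactness of the discrete Laplacian\<close>

text \<open>The edge weight of the operator for \<open>k = 1\<close>. The value 0 off the neighbours
  lets sums run over all pairs of indices.\<close>

definition conductance ::
    "(real^2) set \<Rightarrow> nat \<Rightarrow> (nat \<Rightarrow> real^2) \<Rightarrow> nat \<Rightarrow> nat \<Rightarrow> real" where
  "conductance \<Omega> M x i j =
     (if j \<in> neighbours \<Omega> M x i then face_length \<Omega> M x i j / dist (x i) (x j) else 0)"

lemma conductance_nonneg: "conductance \<Omega> M x i j \<ge> 0"
  by (auto simp: conductance_def neighbours_def)

lemma conductance_commute:
  assumes "i \<in> {1..M}" "j \<in> {1..M}"
  shows "conductance \<Omega> M x i j = conductance \<Omega> M x j i"
  using assms by (auto simp: conductance_def neighbours_def face_length_def face_def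
      Int_commute dist_commute)

text \<open>The discrete Laplacian is exact on \<open>\<phi>\<close>: by \<open>voronoi_polygon_edges_closed\<close> it annihilates affine
  functions, and by \<open>voronoi_polygon_area\<close> it is exact on \<open>dist p (x i)\<^sup>2\<close>.\<close>

lemma discrete_laplacian_quadratic:
  fixes a b :: "real^2"
  assumes grid: "voronoi_grid \<Omega> M x" and bdd: "bounded \<Omega>" and i: "i \<in> interior_indices \<Omega> M x"
  defines "\<phi> \<equiv> \<lambda>p. (p - a) \<bullet> (b - p) / 4"
  shows "(\<Sum>j\<in>{1..M}. conductance \<Omega> M x i j * (\<phi> (x i) - \<phi> (x j))) = cell_area \<Omega> M x i"
proof -
  have iM: "i \<in> {1..M}" and cvi: "control_volume \<Omega> M x i = voronoi_polygon M x i"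
    using i by (auto simp: interior_indices_def control_volume_def)
  have inj: "inj_on x {1..M}"
    using grid by (simp add: voronoi_grid_def)
  note bi = bounded_interior_voronoi_polygon[OF grid bdd i]
  define l where "l j = diameter (voronoi_polygon M x i \<inter> voronoi_polygon M x j)" for j
  define d where "d j = dist (x i) (x j)" for j
  define s where "s = (a + b - 2 *\<^sub>R x i)"
  have g: "conductance \<Omega> M x i j = l j / d j" if "j \<in> {1..M} - {i}" for j
  proof -
    have "face_length \<Omega> M x i j = l j"
      using face_eq_voronoi_polygon_Int[OF grid i] that by (simp add: face_length_def l_def)
    moreover have "l j \<ge> 0"
      unfolding l_def using bi by (intro diameter_ge_0) (auto intro: bounded_subset)
    \<comment> \<open>For a non-neighbour the face length is 0, so the default value agrees with
      \<open>l j / d j\<close>.\<close>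
    ultimately show ?thesis
      using that by (auto simp: conductance_def neighbours_def d_def)
  qed
  have gi: "conductance \<Omega> M x i i = 0"
    by (simp add: conductance_def neighbours_def)
  \<comment> \<open>Exact Taylor expansion of the quadratic \<open>\<phi>\<close> about
    \<open>x i\<close>: a squared distance plus a linear part, which the closing of the edge vectors
    removes.\<close>
  have diff: "\<phi> (x i) - \<phi> (x j) = (d j)\<^sup>2 / 4 - (x j - x i) \<bullet> s / 4" for j
    unfolding \<phi>_def d_def s_def dist_norm power2_norm_eq_inner
    by (simp add: inner_diff_left inner_diff_right inner_add_left inner_add_right inner_commute
        field_simps)
  have "(\<Sum>j\<in>{1..M}. conductance \<Omega> M x i j * (\<phi> (x i) - \<phi> (x j)))
      = (\<Sum>j\<in>{1..M} - {i}. l j / d j * ((d j)\<^sup>2 / 4 - (x j - x i) \<bullet> s / 4))"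
    unfolding diff by (subst sum.remove[OF finite_atLeastAtMost iM]) (use gi g in simp)
  also have "\<dots> = (\<Sum>j\<in>{1..M} - {i}. l j * d j / 4 - (l j / d j) *\<^sub>R (x j - x i) \<bullet> s / 4)"
    by (rule sum.cong) (auto simp: power2_eq_square right_diff_distrib)
  also have "\<dots> = (\<Sum>j\<in>{1..M} - {i}. l j * d j / 4)
      - (\<Sum>j\<in>{1..M} - {i}. (l j / d j) *\<^sub>R (x j - x i)) \<bullet> s / 4"
    by (simp add: sum_subtractf inner_sum_left sum_divide_distrib)
  also have "\<dots> = cell_area \<Omega> M x i"
    using voronoi_polygon_area[OF inj iM bi] voronoi_polygon_edges_closed[OF inj iM bi]
    by (simp add: l_def d_def cell_area_def cvi)
  finally show ?thesis .
qed

section \<open>Summation by parts and Picone's inequality\<close>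

text \<open>Exchanging the indices flips the sign of \<open>y i - y j\<close> and keeps the weight,
  so the sum with \<open>z j\<close> in place of \<open>z i\<close> is the negative of the left-hand
  side.\<close>

lemma sum_symmetric_differences:
  fixes g :: "'i \<Rightarrow> 'i \<Rightarrow> real"
  assumes "\<And>i j. i \<in> A \<Longrightarrow> j \<in> A \<Longrightarrow> g i j = g j i"
  shows "(\<Sum>i\<in>A. \<Sum>j\<in>A. g i j * (y i - y j) * z i) =
    (\<Sum>i\<in>A. \<Sum>j\<in>A. g i j * (y i - y j) * (z i - z j)) / 2"
proof -
  have "(\<Sum>i\<in>A. \<Sum>j\<in>A. g i j * (y i - y j) * z j) = (\<Sum>j\<in>A. \<Sum>i\<in>A. g i j * (y i - y j) * z j)"
    by (rule sum.swap)
  also have "\<dots> = (\<Sum>i\<in>A. \<Sum>j\<in>A. - (g i j * (y i - y j) * z i))"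
    using assms by (intro sum.cong refl) (simp add: algebra_simps)
  finally show ?thesis
    by (simp add: right_diff_distrib sum_subtractf sum_negf)
qed

text \<open>The gap between the two sides is a square divided by \<open>s * t\<close>.\<close>

lemma picone_two_point:
  fixes s t :: real
  assumes "s > 0" "t > 0"
  shows "(s - t) * (u\<^sup>2 / s - v\<^sup>2 / t) \<le> (u - v)\<^sup>2"
proof -
  have "(u - v)\<^sup>2 - (s - t) * (u\<^sup>2 / s - v\<^sup>2 / t) = (t * u - s * v)\<^sup>2 / (s * t)"
    using assms by (simp add: field_simps power2_eq_square)
  also have "\<dots> \<ge> 0" using assms by simp
  finally show ?thesis by simp
qed

text \<open>A discrete Green formula. Its symmetry in \<open>y\<close> and \<open>w\<close> yields
  self-adjointness; for \<open>w = y\<close> it is a weighted sum of squares, monotone in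
  \<open>k\<close>.\<close>

lemma grid_inner_diffusion_op:
  assumes grid: "voronoi_grid \<Omega> M x" and bdd: "bounded \<Omega>" and w: "w \<in> grid_space \<Omega> M x"
  shows "grid_inner \<Omega> M x (diffusion_op \<Omega> M x k y) w =
    (\<Sum>i\<in>{1..M}. \<Sum>j\<in>{1..M}.
      conductance \<Omega> M x i j * k ((1/2) *\<^sub>R (x i + x j)) * (y i - y j) * (w i - w j)) / 2"
proof -
  define c where "c i j = conductance \<Omega> M x i j * k ((1/2) *\<^sub>R (x i + x j))" for i j
  let ?I = "interior_indices \<Omega> M x"
  have flux: "cell_area \<Omega> M x i * diffusion_op \<Omega> M x k y i = (\<Sum>j\<in>{1..M}. c i j * (y i - y j))"
    if i: "i \<in> ?I" for i
  proof -
    have iM: "i \<in> {1..M}" and cvi: "control_volume \<Omega> M x i = voronoi_polygon M x i"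
      using i by (auto simp: interior_indices_def control_volume_def)
    \<comment> \<open>Positivity allows the factor \<open>1 / cell_area \<Omega> M x i\<close> of
      the operator to be cancelled.\<close>
    have "cell_area \<Omega> M x i > 0"
      using voronoi_polygon_area_pos[OF _ iM bounded_interior_voronoi_polygon[OF grid bdd i]] grid
      by (simp add: cell_area_def cvi voronoi_grid_def)
    then have "cell_area \<Omega> M x i * diffusion_op \<Omega> M x k y i =
        (\<Sum>j\<in>neighbours \<Omega> M x i. c i j * (y i - y j))"
      using i by (simp add: diffusion_op_def c_def conductance_def flip: sum_negf)
        (intro sum.cong; simp add: algebra_simps diff_divide_distrib)
    also have "\<dots> = (\<Sum>j\<in>{1..M}. c i j * (y i - y j))"
      by (rule sum.mono_neutral_left) (auto simp: neighbours_def c_def conductance_def)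
    finally show ?thesis .
  qed
  have "grid_inner \<Omega> M x (diffusion_op \<Omega> M x k y) w = (\<Sum>i\<in>?I. \<Sum>j\<in>{1..M}. c i j * (y i - y j) * w i)"
    unfolding grid_inner_def by (intro sum.cong refl) (simp add: flux sum_distrib_right)
  also have "\<dots> = (\<Sum>i\<in>{1..M}. \<Sum>j\<in>{1..M}. c i j * (y i - y j) * w i)"
    by (rule sum.mono_neutral_left) (use w in \<open>auto simp: interior_indices_def grid_space_def\<close>)
  also have "\<dots> = (\<Sum>i\<in>{1..M}. \<Sum>j\<in>{1..M}. c i j * (y i - y j) * (w i - w j)) / 2"
    by (rule sum_symmetric_differences)
       (simp add: c_def conductance_commute add.commute)
  finally show ?thesis by (simp add: c_def)
qed

section \<open>Self-adjointness and the lower bound\<close>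

theorem theorem6:
  fixes \<Omega> :: "(real^2) set" and M :: nat and x :: "nat \<Rightarrow> real^2"
    and k :: "real^2 \<Rightarrow> real" and \<kappa>\<^sub>1 l\<^sub>1 l\<^sub>2 M\<^sub>0 :: real and a b :: "real^2"
  assumes "convex_polygon \<Omega>"
    and "voronoi_grid \<Omega> M x"
    and "continuously_differentiable_on (closure \<Omega>) k"
    and "\<kappa>\<^sub>1 > 0" and "\<forall>p\<in>closure \<Omega>. k p \<ge> \<kappa>\<^sub>1"
    and "closure \<Omega> \<subseteq> cbox a b"
    and "l\<^sub>1 = b $ 1 - a $ 1" and "l\<^sub>2 = b $ 2 - a $ 2"
    and "M\<^sub>0 = l\<^sub>1\<^sup>2 / 16 + l\<^sub>2\<^sup>2 / 16"
  shows "is_adjoint \<Omega> M x (diffusion_op \<Omega> M x k) (diffusion_op \<Omega> M x k) \<and>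
         bounded_below_by \<Omega> M x (diffusion_op \<Omega> M x k) (\<kappa>\<^sub>1 / M\<^sub>0)"
proof
  let ?I = "interior_indices \<Omega> M x" and ?D = "diffusion_op \<Omega> M x k"
  let ?g = "conductance \<Omega> M x" and ?V = "cell_area \<Omega> M x"
  have grid: "voronoi_grid \<Omega> M x" by fact
  have op: "open \<Omega>" and cv: "convex (closure \<Omega>)"
    using assms(1) by (auto simp: convex_polygon_def convex_closure)
  have bdd: "bounded \<Omega>"
    using bounded_subset[OF bounded_cbox] closure_subset assms(6) by (meson order_trans)
  have inD: "?D y \<in> grid_space \<Omega> M x" for y
    by (simp add: grid_space_def diffusion_op_def)
  show "is_adjoint \<Omega> M x ?D ?D"
    unfolding is_adjoint_def
  proof (intro conjI ballI inD)
    fix y w assume "y \<in> grid_space \<Omega> M x" "w \<in> grid_space \<Omega> M x"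
    moreover have "grid_inner \<Omega> M x y (?D w) = grid_inner \<Omega> M x (?D w) y"
      by (simp add: grid_inner_def mult_ac)
    ultimately show "grid_inner \<Omega> M x (?D y) w = grid_inner \<Omega> M x y (?D w)"
      using grid_inner_diffusion_op[OF grid bdd, of w k y] grid_inner_diffusion_op[OF grid bdd, of y k w]
      by (simp add: mult_ac)
  qed
  show "bounded_below_by \<Omega> M x ?D (\<kappa>\<^sub>1 / M\<^sub>0)"
    unfolding bounded_below_by_def
  proof
    fix y assume y: "y \<in> grid_space \<Omega> M x"
    define \<phi> where "\<phi> p = (p - a) \<bullet> (b - p) / 4" for p
    \<comment> \<open>\<open>\<phi>\<close> may vanish at a boundary node, for instance at a corner
      of the box, so the quotient is formed only at interior nodes; the value 0 elsewhere matches
      \<open>y\<close>.\<close>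
    define z where "z i = (if i \<in> ?I then (y i)\<^sup>2 / \<phi> (x i) else 0)" for i
    have xcl: "x i \<in> closure \<Omega>" if "i \<in> {1..M}" for i
      using grid that by (auto simp: voronoi_grid_def)
    have \<phi>: "\<phi> p = ((p$1 - a$1) * (b$1 - p$1) + (p$2 - a$2) * (b$2 - p$2)) / 4" for p
      by (simp add: \<phi>_def inner_vec_def sum_2)
    have \<phi>_nonneg: "\<phi> (x i) \<ge> 0" if "i \<in> {1..M}" for i
      using xcl[OF that] assms(6) by (auto simp: \<phi> mem_box_cart forall_2)
    have \<phi>_pos: "\<phi> (x i) > 0" if "i \<in> ?I" for i
    proof -
      \<comment> \<open>Openness of \<open>\<Omega>\<close> keeps interior nodes off the boundary of
        the box, where positivity of \<open>\<phi>\<close> could fail.\<close>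
      have "\<Omega> \<subseteq> interior (cbox a b)"
        using op assms(6) closure_subset by (meson interior_maximal order_trans)
      then have "x i \<in> box a b"
        using that by (auto simp: interior_indices_def interior_cbox)
      then show ?thesis by (auto simp: \<phi> mem_box_cart forall_2 intro!: add_pos_pos)
    qed
    \<comment> \<open>The maximum is at the midpoint; this 1/4 and the 1/4 in \<open>\<phi>\<close>
      make the 1/16 of \<open>M\<^sub>0\<close>.\<close>
    have parabola: "(s - r) * (t - s) \<le> (t - r)\<^sup>2 / 4" for r s t :: real
      using zero_le_power2[of "2 * s - r - t"] by (simp add: power2_eq_square algebra_simps)
    have "\<phi> p \<le> (l\<^sub>1\<^sup>2 / 4 + l\<^sub>2\<^sup>2 / 4) / 4" for p
      unfolding \<phi> assms(7,8) by (intro divide_right_mono add_mono parabola) simp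
    then have \<phi>_le: "\<phi> p \<le> M\<^sub>0" for p
      by (simp add: assms(9) add_divide_distrib)
    have y0: "y i = 0" if "i \<notin> ?I" for i
      using y that by (simp add: grid_space_def)
    have z_le: "(\<phi> (x i) - \<phi> (x j)) * (z i - z j) \<le> (y i - y j)\<^sup>2"
      if "i \<in> {1..M}" "j \<in> {1..M}" for i j
    proof -
      \<comment> \<open>Replaces Picone's inequality when only one node is interior:
        \<open>y\<close> and \<open>z\<close> vanish at the other, and \<open>\<phi> \<ge> 0\<close>
        suffices there.\<close>
      have *: "(\<phi> (x i) - \<phi> (x j)) * ((y i)\<^sup>2 / \<phi> (x i)) \<le> (y i)\<^sup>2"
        if "i \<in> ?I" "j \<in> {1..M}" for i j
        using \<phi>_pos[OF that(1)] mult_right_mono[of "\<phi> (x i) - \<phi> (x j)" "\<phi> (x i)" "(y i)\<^sup>2 / \<phi> (x i)"]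
          \<phi>_nonneg[OF that(2)] by simp
      have swap: "(\<phi> (x i) - \<phi> (x j)) * (z i - z j) = (\<phi> (x j) - \<phi> (x i)) * (z j - z i)"
        by (simp add: algebra_simps)
      show ?thesis
      proof (cases "i \<in> ?I")
        case True
        then show ?thesis
          using picone_two_point[OF \<phi>_pos \<phi>_pos, of i j "y i" "y j"] *[of i j] that y0[of j]
          by (cases "j \<in> ?I") (simp_all add: z_def)
      next
        case False
        then show ?thesis
          using *[of j i] that y0[of i] y0[of j] unfolding swap
          by (cases "j \<in> ?I") (simp_all add: z_def)
      qed
    qed
    have "\<kappa>\<^sub>1 / M\<^sub>0 * grid_inner \<Omega> M x y y = (\<Sum>i\<in>?I. \<kappa>\<^sub>1 * (?V i * ((y i)\<^sup>2 / M\<^sub>0)))"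
      unfolding grid_inner_def sum_distrib_left by (simp add: power2_eq_square mult.assoc)
    also have "\<dots> \<le> (\<Sum>i\<in>?I. \<kappa>\<^sub>1 * (?V i * z i))"
    proof (intro sum_mono mult_left_mono)
      fix i assume i: "i \<in> ?I"
      show "(y i)\<^sup>2 / M\<^sub>0 \<le> z i"
        using frac_le[OF _ order_refl \<phi>_pos[OF i] \<phi>_le] i by (simp add: z_def)
    qed (use assms(4) in \<open>simp_all add: cell_area_def\<close>)
    \<comment> \<open>The cell area is expressed through the discrete Laplacian of
      \<open>\<phi>\<close>, making the sum a pairing of that Laplacian with
      \<open>z\<close>.\<close>
    also have "\<dots> = \<kappa>\<^sub>1 * (\<Sum>i\<in>?I. \<Sum>j\<in>{1..M}. ?g i j * (\<phi> (x i) - \<phi> (x j)) * z i)"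
      using discrete_laplacian_quadratic[OF grid bdd, of _ a b]
      unfolding sum_distrib_left[symmetric] sum_distrib_right[symmetric] by (simp add: \<phi>_def)
    also have "(\<Sum>i\<in>?I. \<Sum>j\<in>{1..M}. ?g i j * (\<phi> (x i) - \<phi> (x j)) * z i)
        = (\<Sum>i\<in>{1..M}. \<Sum>j\<in>{1..M}. ?g i j * (\<phi> (x i) - \<phi> (x j)) * z i)"
      by (rule sum.mono_neutral_left) (auto simp: interior_indices_def z_def)
    also have "\<dots> = (\<Sum>i\<in>{1..M}. \<Sum>j\<in>{1..M}. ?g i j * (\<phi> (x i) - \<phi> (x j)) * (z i - z j)) / 2"
      by (rule sum_symmetric_differences) (simp add: conductance_commute)
    also have "\<kappa>\<^sub>1 * \<dots> = (\<Sum>i\<in>{1..M}. \<Sum>j\<in>{1..M}.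
        ?g i j * \<kappa>\<^sub>1 * ((\<phi> (x i) - \<phi> (x j)) * (z i - z j))) / 2"
      unfolding times_divide_eq_right sum_distrib_left by (simp add: mult_ac)
    also have "\<dots> \<le> (\<Sum>i\<in>{1..M}. \<Sum>j\<in>{1..M}.
        ?g i j * k ((1/2) *\<^sub>R (x i + x j)) * (y i - y j)\<^sup>2) / 2"
    proof (intro divide_right_mono sum_mono)
      fix i j assume ij: "i \<in> {1..M}" "j \<in> {1..M}"
      \<comment> \<open>The bound on \<open>k\<close> is available at the midpoint because a convex
        set contains it, whether or not the two nodes are neighbours.\<close>
      have "(1/2) *\<^sub>R (x i + x j) \<in> closure \<Omega>"
        using convexD[OF cv xcl[OF ij(1)] xcl[OF ij(2)], of "1/2" "1/2"]
        by (simp add: scaleR_add_right)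
      then have "\<kappa>\<^sub>1 \<le> k ((1/2) *\<^sub>R (x i + x j))"
        using assms(5) by blast
      then have "?g i j * \<kappa>\<^sub>1 * (y i - y j)\<^sup>2 \<le> ?g i j * k ((1/2) *\<^sub>R (x i + x j)) * (y i - y j)\<^sup>2"
        by (intro mult_right_mono mult_left_mono conductance_nonneg) auto
      moreover have "?g i j * \<kappa>\<^sub>1 * ((\<phi> (x i) - \<phi> (x j)) * (z i - z j)) \<le> ?g i j * \<kappa>\<^sub>1 * (y i - y j)\<^sup>2"
        using assms(4) by (intro mult_left_mono z_le ij) (simp add: conductance_nonneg)
      ultimately show "?g i j * \<kappa>\<^sub>1 * ((\<phi> (x i) - \<phi> (x j)) * (z i - z j))
          \<le> ?g i j * k ((1/2) *\<^sub>R (x i + x j)) * (y i - y j)\<^sup>2"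
        by linarith
    qed simp
    also have "\<dots> = grid_inner \<Omega> M x (?D y) y"
      using grid_inner_diffusion_op[OF grid bdd y] by (simp add: power2_eq_square mult.assoc)
    finally show "\<kappa>\<^sub>1 / M\<^sub>0 * grid_inner \<Omega> M x y y \<le> grid_inner \<Omega> M x (?D y) y" .
  qed
qed

end
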